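(* Let $(i,j)\in\mathcal I^2$, $i\neq j$, be a pair of neighboring vehicles, and assume that the initial speeds $v_i(0),v_j(0)$ are feasible. Then the hybrid motion-planning (MPC) formulation with the safety-distance constraints and the free-space agreement guarantees longitudinal safety. That is, suppose the speeds $v_i(t),v_j(t)$ and lanes $z_i(t),z_j(t)$, $t\in\{0,\dots,T\}$, satisfy, for both vehicles, the constraints of the hybrid motion-planning problem, the safety-distance constraint (for all $t\in\{0,\dots,T\}$) and the free-space agreement (for all $t\in\{1,\dots,T\}$), all written out in the context and imposed both by $i$ with respect to $j$ and by $j$ with respect to $i$. Then the pair $(i,j)$ is longitudinally safe over the prediction horizon $T$: for every $t\in\{0,\dots,T\}$ with $z_i(t)=z_j(t)$ one has $|d_{i,j}(t)|\ge d_i^{\mathrm s}(t)$ and, furthermore, if $t+1\le T$ and $z_i(t+1)=z_j(t+1)$, then $d_{i,j}(t+1)\cdot d_{i,j}(t)\ge 0$.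
   Context: Setting. $\mathcal I=\{1,\dots,N\}$ is a set of vehicles on a highway with lane set $\mathcal L=\{1,\dots,L\}$; $T\ge 1$ is an integer prediction horizon and $\tau>0$ is the length of a time interval. At time $t\in\{0,\dots,T\}$ vehicle $i$ has longitudinal speed $v_i(t)\in\mathbb R$ and lane $z_i(t)\in\mathcal L$. The signed longitudinal distance $d_{i,j}(t)\in\mathbb R$ satisfies $d_{j,i}(t)=-d_{i,j}(t)$ and $$d_{i,j}(t+1)=d_{i,j}(t)+\tau\,(v_j(t)-v_i(t)).$$ Write $v_{i,j}(t)=v_j(t)-v_i(t)$ and $l_{i,j}(t)=z_j(t)-z_i(t)$. The safety distance of vehicle $i$ is $d_i^{\mathrm s}(t)=d_i^{\mathrm s}(v_i(t))>0$, a positive function of its current speed. Vehicles $i$ and $j$ are neighbors, written $j\in\mathcal N_i$, if $|d_{i,j}|\le\bar d$ for a fixed interaction distance $\bar d>0$; the coupling constraints below are imposed between neighbors. Hybrid motion-planning (MPC) problem of vehicle $i$: choose $\boldsymbol v_i=(v_i(1),\dots,v_i(T))$ and $\boldsymbol z_i=(z_i(1),\dots,z_i(T))$ minimizing $|\boldsymbol v_i-\boldsymbol v_i^{\mathrm d}|+r_i|\boldsymbol z_i-\boldsymbol z_i^{\mathrm d}|$ (given desired profiles $\boldsymbol v_i^{\mathrm d},\boldsymbol z_i^{\mathrm d}$ and a weight $r_i>0$), subject to, for all $t\in\{0,\dots,T-1\}$, $$v_i(t+1)\in[0,\bar v_i]\cap[v_i(t)-\Delta_i,v_i(t)+\Delta_i],\qquad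 z_i(t+1)\in\mathcal L\cap[z_i(t)-1,z_i(t)+1],$$ where $\bar v_i>0$ (maximum speed) and $\Delta_i>0$ (maximum acceleration/deceleration) are given. Safety-distance constraint (vehicle $i$ with respect to $j$), for all $t\in\{0,\dots,T\}$: if $l_{i,j}(t)=0$ and $|d_{i,j}(t)|\ge 0$, then $|d_{i,j}(t)|\ge d_i^{\mathrm s}(t)$. Free-space agreement (vehicle $i$ with respect to $j$), for all $t\in\{1,\dots,T\}$: - if $l_{i,j}(t)=0$ and $d_{i,j}(t)\ge 0$, then $v_{i,j}(t)\ge-\tfrac12\,\dfrac{d_{i,j}(t)-d_i^{\mathrm s}(t)}{\tau}$; - if $l_{i,j}(t)=0$ and $d_{i,j}(t)\le 0$, then $v_{i,j}(t)\le-\tfrac12\,\dfrac{d_{i,j}(t)+d_i^{\mathrm s}(t)}{\tau}$. Feasibility of the initial speeds means that $v_i(0),v_j(0)$ are admissible for the constraints listed above, i.e. they lie in $[0,\bar v_i]$ and $[0,\bar v_j]$ and satisfy those constraints that are imposed at $t=0$.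
   Formalization: Feasibility of the initial speeds is taken to include the free-space agreement at t=0; with the agreement imposed only for t in {1,...,T}, the claim fails in the first step (e.g. τ=1, safety distance 5, constant speeds 30 and 0, distance 10 becoming -20). *)

theory Defs
  imports Complex_Main
begin

text \<open>
  Vehicles are the numbers 1..N, lanes the integers 1..L and times the natural numbers 0..T.
  A speed profile \<open>v\<close>, a lane profile \<open>z\<close> and the signed distances \<open>d\<close> are total functions, read as
  \<open>v i t\<close>, \<open>z i t\<close> and \<open>d i j t\<close>; only their values at vehicles in 1..N and times in 0..T are
  ever constrained. Lanes are integers so that lane differences do not truncate.
  The safety distance of vehicle \<open>i\<close> at time \<open>t\<close> is \<open>ds i (v i t)\<close>.
\<close>

definition vehicles :: "nat \<Rightarrow> nat set" where
  "vehicles N = {1..N}"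

definition lanes :: "nat \<Rightarrow> int set" where
  "lanes L = {1..int L}"

definition rel_speed :: "(nat \<Rightarrow> nat \<Rightarrow> real) \<Rightarrow> nat \<Rightarrow> nat \<Rightarrow> nat \<Rightarrow> real" where
  "rel_speed v i j t = v j t - v i t"

definition rel_lane :: "(nat \<Rightarrow> nat \<Rightarrow> int) \<Rightarrow> nat \<Rightarrow> nat \<Rightarrow> nat \<Rightarrow> int" where
  "rel_lane z i j t = z j t - z i t"

definition distance_dynamics ::
  "nat \<Rightarrow> nat \<Rightarrow> real \<Rightarrow> (nat \<Rightarrow> nat \<Rightarrow> real) \<Rightarrow> (nat \<Rightarrow> nat \<Rightarrow> nat \<Rightarrow> real) \<Rightarrow> bool" where
  "distance_dynamics N T \<tau> v d \<longleftrightarrow>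
     (\<forall>i\<in>vehicles N. \<forall>j\<in>vehicles N.
        (\<forall>t\<in>{0..T}. d j i t = - d i j t) \<and>
        (\<forall>t\<in>{0..<T}. d i j (t + 1) = d i j t + \<tau> * rel_speed v i j t))"

text \<open>The neighbor relation is evaluated at the planning instant, time 0.\<close>

definition neighbors ::
  "nat \<Rightarrow> real \<Rightarrow> (nat \<Rightarrow> nat \<Rightarrow> nat \<Rightarrow> real) \<Rightarrow> nat \<Rightarrow> nat set" where
  "neighbors N dbar d i = {j \<in> vehicles N. j \<noteq> i \<and> \<bar>d i j 0\<bar> \<le> dbar}"

definition motion_constraints ::
  "nat \<Rightarrow> nat \<Rightarrow> (nat \<Rightarrow> real) \<Rightarrow> (nat \<Rightarrow> real) \<Rightarrow> (nat \<Rightarrow> nat \<Rightarrow> real) \<Rightarrow> (nat \<Rightarrow> nat \<Rightarrow> int) \<Rightarrow>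
   nat \<Rightarrow> bool" where
  "motion_constraints L T vbar \<Delta> v z i \<longleftrightarrow>
     (\<forall>t\<in>{0..<T}.
        v i (t + 1) \<in> {0..vbar i} \<inter> {v i t - \<Delta> i..v i t + \<Delta> i} \<and>
        z i (t + 1) \<in> lanes L \<inter> {z i t - 1..z i t + 1})"

text \<open>The premise \<open>\<bar>d i j t\<bar> \<ge> 0\<close> is vacuous; it is kept to match the source formulation.\<close>

definition safety_distance_at ::
  "(nat \<Rightarrow> real \<Rightarrow> real) \<Rightarrow> (nat \<Rightarrow> nat \<Rightarrow> real) \<Rightarrow> (nat \<Rightarrow> nat \<Rightarrow> int) \<Rightarrow>
   (nat \<Rightarrow> nat \<Rightarrow> nat \<Rightarrow> real) \<Rightarrow> nat \<Rightarrow> nat \<Rightarrow> nat \<Rightarrow> bool" where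
  "safety_distance_at ds v z d i j t \<longleftrightarrow>
     (rel_lane z i j t = 0 \<and> \<bar>d i j t\<bar> \<ge> 0 \<longrightarrow> \<bar>d i j t\<bar> \<ge> ds i (v i t))"

definition free_space_at ::
  "real \<Rightarrow> (nat \<Rightarrow> real \<Rightarrow> real) \<Rightarrow> (nat \<Rightarrow> nat \<Rightarrow> real) \<Rightarrow> (nat \<Rightarrow> nat \<Rightarrow> int) \<Rightarrow>
   (nat \<Rightarrow> nat \<Rightarrow> nat \<Rightarrow> real) \<Rightarrow> nat \<Rightarrow> nat \<Rightarrow> nat \<Rightarrow> bool" where
  "free_space_at \<tau> ds v z d i j t \<longleftrightarrow>
     (rel_lane z i j t = 0 \<and> d i j t \<ge> 0 \<longrightarrow>
        rel_speed v i j t \<ge> - (1 / 2) * ((d i j t - ds i (v i t)) / \<tau>)) \<and>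
     (rel_lane z i j t = 0 \<and> d i j t \<le> 0 \<longrightarrow>
        rel_speed v i j t \<le> - (1 / 2) * ((d i j t + ds i (v i t)) / \<tau>))"

text \<open>
  Admissibility of the given initial speed of \<open>i\<close> with respect to \<open>j\<close>: it lies in the speed range
  and meets both coupling constraints at time 0. The free-space agreement has to be part of this:
  imposed on times 1..T only, it would leave the initial speeds, and hence the sign of the
  distance at time 1, unrestricted.
\<close>

definition feasible_initial_speed ::
  "real \<Rightarrow> (nat \<Rightarrow> real \<Rightarrow> real) \<Rightarrow> (nat \<Rightarrow> real) \<Rightarrow> (nat \<Rightarrow> nat \<Rightarrow> real) \<Rightarrow> (nat \<Rightarrow> nat \<Rightarrow> int) \<Rightarrow>
   (nat \<Rightarrow> nat \<Rightarrow> nat \<Rightarrow> real) \<Rightarrow> nat \<Rightarrow> nat \<Rightarrow> bool" where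
  "feasible_initial_speed \<tau> ds vbar v z d i j \<longleftrightarrow>
     v i 0 \<in> {0..vbar i} \<and>
     safety_distance_at ds v z d i j 0 \<and>
     free_space_at \<tau> ds v z d i j 0"

definition longitudinally_safe ::
  "nat \<Rightarrow> (nat \<Rightarrow> real \<Rightarrow> real) \<Rightarrow> (nat \<Rightarrow> nat \<Rightarrow> real) \<Rightarrow> (nat \<Rightarrow> nat \<Rightarrow> int) \<Rightarrow>
   (nat \<Rightarrow> nat \<Rightarrow> nat \<Rightarrow> real) \<Rightarrow> nat \<Rightarrow> nat \<Rightarrow> bool" where
  "longitudinally_safe T ds v z d i j \<longleftrightarrow>
     (\<forall>t\<in>{0..T}. z i t = z j t \<longrightarrow>
        \<bar>d i j t\<bar> \<ge> ds i (v i t) \<and>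
        (t + 1 \<le> T \<and> z i (t + 1) = z j (t + 1) \<longrightarrow> d i j (t + 1) * d i j t \<ge> 0))"

end

theory Submission
  imports Defs
begin

text \<open>
  Multiplying the free-space agreement by \<open>\<tau>\<close> and adding it to the distance update shows that the
  next distance is at least half of \<open>d + ds\<close> when \<open>d \<ge> 0\<close>, and at most half of
  \<open>d - ds\<close> when \<open>d \<le> 0\<close>, so its sign is that of the current distance.
\<close>

lemma free_space_at_imp_sign_preserved:
  assumes "\<tau> > 0" and "ds i (v i t) \<ge> 0" and "rel_lane z i j t = 0"
    and "free_space_at \<tau> ds v z d i j t"
  shows "(d i j t + \<tau> * rel_speed v i j t) * d i j t \<ge> 0"
\<comment> \<open>The agreement bounds the relative speed on one side only, and the sign of the
  current distance decides which side. Distance zero is treated in the first case.\<close>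
proof (cases "d i j t \<ge> 0")
  case True
  then have "rel_speed v i j t \<ge> - (1 / 2) * ((d i j t - ds i (v i t)) / \<tau>)"
    using assms(3,4) by (simp add: free_space_at_def)
  then have "2 * (\<tau> * rel_speed v i j t) \<ge> ds i (v i t) - d i j t"
    using \<open>\<tau> > 0\<close> by (simp add: field_simps)
  \<comment> \<open>Twice the left-hand side is at least \<open>d i j t + ds i (v i t)\<close>, a
    sum of two nonnegative terms.\<close>
  with True assms(2) have "d i j t + \<tau> * rel_speed v i j t \<ge> 0"
    by linarith
  with True show ?thesis
    by simp
next
  case False
  then have "rel_speed v i j t \<le> - (1 / 2) * ((d i j t + ds i (v i t)) / \<tau>)"
    using assms(3,4) by (simp add: free_space_at_def)
  then have "2 * (\<tau> * rel_speed v i j t) \<le> - ds i (v i t) - d i j t"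
    using \<open>\<tau> > 0\<close> by (simp add: field_simps)
  with False assms(2) have "d i j t + \<tau> * rel_speed v i j t \<le> 0"
    by linarith
  with False show ?thesis
    by (simp add: mult_nonpos_nonpos)
qed

theorem proposition1:
  fixes N L T :: nat
    and \<tau> dbar :: real
    and vbar \<Delta> :: "nat \<Rightarrow> real"
    and ds :: "nat \<Rightarrow> real \<Rightarrow> real"
    and v :: "nat \<Rightarrow> nat \<Rightarrow> real"
    and z :: "nat \<Rightarrow> nat \<Rightarrow> int"
    and d :: "nat \<Rightarrow> nat \<Rightarrow> nat \<Rightarrow> real"
    and i j :: nat
  assumes "T \<ge> 1" and "\<tau> > 0" and "dbar > 0"
    and "\<forall>k\<in>vehicles N. vbar k > 0 \<and> \<Delta> k > 0"
    and "\<forall>k\<in>vehicles N. \<forall>s. ds k s > 0"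
    and "\<forall>k\<in>vehicles N. \<forall>t\<in>{0..T}. z k t \<in> lanes L"
    and "distance_dynamics N T \<tau> v d"
    and "i \<in> vehicles N" and "j \<in> vehicles N" and "i \<noteq> j"
    and "j \<in> neighbors N dbar d i"
    and "feasible_initial_speed \<tau> ds vbar v z d i j"
    and "feasible_initial_speed \<tau> ds vbar v z d j i"
    and "motion_constraints L T vbar \<Delta> v z i"
    and "motion_constraints L T vbar \<Delta> v z j"
    and "\<forall>t\<in>{0..T}. safety_distance_at ds v z d i j t \<and> safety_distance_at ds v z d j i t"
    and "\<forall>t\<in>{1..T}. free_space_at \<tau> ds v z d i j t \<and> free_space_at \<tau> ds v z d j i t"
  shows "longitudinally_safe T ds v z d i j"
  unfolding longitudinally_safe_def
proof (intro ballI impI conjI)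
  fix t assume t: "t \<in> {0..T}" and "z i t = z j t"
  then have lane: "rel_lane z i j t = 0"
    by (simp add: rel_lane_def)
  show "\<bar>d i j t\<bar> \<ge> ds i (v i t)"
    using assms(16) t lane by (simp add: safety_distance_at_def)
  assume next_time: "t + 1 \<le> T \<and> z i (t + 1) = z j (t + 1)"
  \<comment> \<open>The agreement is imposed from time 1 on; at time 0 it comes from the feasibility
    of the initial speed of \<open>i\<close>.\<close>
  have "free_space_at \<tau> ds v z d i j t"
    using assms(12,17) t by (cases "t = 0") (auto simp: feasible_initial_speed_def)
  moreover have "ds i (v i t) \<ge> 0"
    using assms(5,8) by (auto intro: less_imp_le)
  \<comment> \<open>The update law covers only times before \<open>T\<close>, and
    \<open>t + 1 \<le> T\<close> puts \<open>t\<close> among them.\<close>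
  moreover have "d i j (t + 1) = d i j t + \<tau> * rel_speed v i j t"
    using assms(7,8,9) next_time unfolding distance_dynamics_def
    by (meson atLeastLessThan_iff le0 less_add_one order_less_le_trans)
  ultimately show "d i j (t + 1) * d i j t \<ge> 0"
    using free_space_at_imp_sign_preserved[OF \<open>\<tau> > 0\<close>] lane by simp
qed

end
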